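(* $\mathbf{JIDL_1}=\mathbf{DStHC}\vee\mathbf{V(D_2)}$, where the join is taken in the lattice of subvarieties of $\mathbf{DQD}$ and $\mathbf{V(D_2)}$ is the variety generated by $\mathbf{D_2}$.
   Context: A semi-Heyting algebra is an algebra $\langle L,\vee,\wedge,\to,0,1\rangle$ such that $\langle L,\vee,\wedge,0,1\rangle$ is a bounded lattice and the identities $x\wedge(x\to y)\approx x\wedge y$, $x\wedge(y\to z)\approx x\wedge[(x\wedge y)\to(x\wedge z)]$, $x\to x\approx 1$ hold; it is a Heyting algebra if moreover $(x\wedge y)\to y\approx 1$. Write $x^*:=x\to 0$. A $\mathbf{DQD}$-algebra (dually quasi-De Morgan semi-Heyting algebra) is an algebra $\langle L,\vee,\wedge,\to,{}',0,1\rangle$ whose reduct $\langle L,\vee,\wedge,\to,0,1\rangle$ is a semi-Heyting algebra and which satisfies: $0'\approx 1$ and $1'\approx 0$; $(x\wedge y)'\approx x'\vee y'$; $(x\vee y)''\approx x''\vee y''$; $x''\le x$. $\mathbf{DQD}$ denotes the variety of all $\mathbf{DQD}$-algebras. $\mathbf{JIDL_1}$ is the subvariety of $\mathbf{DQD}$ defined by the identities $x'\vee(y\to z)\approx(x'\vee y)\to(x'\vee z)$, $(x\to y)\vee(y\to x)\approx 1$, and $x\wedge x'^{*}\approx (x\wedge x'^{*})'^{*}$ (where $z'^*$ means $(z')^*$); in the presence of the first identity, the last is equivalent to the level-1 identity $x\wedge x'^*\approx x\wedge x'^*\wedge x'^*{}'^*$. A dually Stone Heyting chain is a $\mathbf{DQD}$-algebra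 satisfying $x'\wedge x''\approx 0$ whose semi-Heyting reduct is a Heyting algebra and whose lattice reduct is a chain; $\mathbf{DStHC}$ is the variety generated by all dually Stone Heyting chains. $\mathbf{D_2}$ is the $\mathbf{DQD}$-algebra whose reduct without $'$ is the four-element Boolean algebra $\{0,a,b,1\}$ with its Heyting implication ($x\to y$ is the join of the complement of $x$ with $y$), and with $0'=1$, $1'=0$, $a'=a$, $b'=b$. *)

theory Defs
  imports "HOL-Algebra.Lattice"
begin

section \<open>Dually quasi-De Morgan semi-Heyting algebras\<close>

record 'a alg = "'a partial_object" +
  ljoin :: "'a \<Rightarrow> 'a \<Rightarrow> 'a" (infixl \<open>\<^bold>\<or>\<index>\<close> 65)
  lmeet :: "'a \<Rightarrow> 'a \<Rightarrow> 'a" (infixl \<open>\<^bold>\<and>\<index>\<close> 70)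
  limp :: "'a \<Rightarrow> 'a \<Rightarrow> 'a" (infixr \<open>\<^bold>\<rightarrow>\<index>\<close> 60)
  lprime :: "'a \<Rightarrow> 'a" (\<open>_\<acute>\<index>\<close> [1000] 1000)
  lzero :: "'a" (\<open>\<zero>\<index>\<close>)
  lone :: "'a" (\<open>\<one>\<index>\<close>)

text \<open>The postfix star is the pseudocomplement \<open>x\<^sup>* = x \<rightarrow> 0\<close>; thus \<open>x\<acute>\<star>\<close> is \<open>(x')\<^sup>*\<close>.\<close>

definition star :: "'a alg \<Rightarrow> 'a \<Rightarrow> 'a" (\<open>_\<star>\<index>\<close> [1000] 1000) where
  "x\<star>\<^bsub>L\<^esub> = x \<^bold>\<rightarrow>\<^bsub>L\<^esub> \<zero>\<^bsub>L\<^esub>"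

locale algebra =
  fixes L :: "'a alg" (structure)
  assumes join_closed: "\<lbrakk>x \<in> carrier L; y \<in> carrier L\<rbrakk> \<Longrightarrow> x \<^bold>\<or> y \<in> carrier L"
    and meet_closed: "\<lbrakk>x \<in> carrier L; y \<in> carrier L\<rbrakk> \<Longrightarrow> x \<^bold>\<and> y \<in> carrier L"
    and imp_closed: "\<lbrakk>x \<in> carrier L; y \<in> carrier L\<rbrakk> \<Longrightarrow> x \<^bold>\<rightarrow> y \<in> carrier L"
    and prime_closed: "x \<in> carrier L \<Longrightarrow> x\<acute> \<in> carrier L"
    and zero_closed: "\<zero> \<in> carrier L"
    and one_closed: "\<one> \<in> carrier L"

locale bounded_lattice_algebra = algebra +
  assumes join_assoc: "\<lbrakk>x \<in> carrier L; y \<in> carrier L; z \<in> carrier L\<rbrakk> \<Longrightarrow> (x \<^bold>\<or> y) \<^bold>\<or> z = x \<^bold>\<or> (y \<^bold>\<or> z)"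
    and meet_assoc: "\<lbrakk>x \<in> carrier L; y \<in> carrier L; z \<in> carrier L\<rbrakk> \<Longrightarrow> (x \<^bold>\<and> y) \<^bold>\<and> z = x \<^bold>\<and> (y \<^bold>\<and> z)"
    and join_comm: "\<lbrakk>x \<in> carrier L; y \<in> carrier L\<rbrakk> \<Longrightarrow> x \<^bold>\<or> y = y \<^bold>\<or> x"
    and meet_comm: "\<lbrakk>x \<in> carrier L; y \<in> carrier L\<rbrakk> \<Longrightarrow> x \<^bold>\<and> y = y \<^bold>\<and> x"
    and join_absorb: "\<lbrakk>x \<in> carrier L; y \<in> carrier L\<rbrakk> \<Longrightarrow> x \<^bold>\<or> (x \<^bold>\<and> y) = x"
    and meet_absorb: "\<lbrakk>x \<in> carrier L; y \<in> carrier L\<rbrakk> \<Longrightarrow> x \<^bold>\<and> (x \<^bold>\<or> y) = x"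
    and zero_least: "x \<in> carrier L \<Longrightarrow> \<zero> \<^bold>\<and> x = \<zero>"
    and one_greatest: "x \<in> carrier L \<Longrightarrow> x \<^bold>\<and> \<one> = x"

locale semi_heyting_algebra = bounded_lattice_algebra +
  assumes meet_imp: "\<lbrakk>x \<in> carrier L; y \<in> carrier L\<rbrakk> \<Longrightarrow> x \<^bold>\<and> (x \<^bold>\<rightarrow> y) = x \<^bold>\<and> y"
    and meet_imp_distrib: "\<lbrakk>x \<in> carrier L; y \<in> carrier L; z \<in> carrier L\<rbrakk>
      \<Longrightarrow> x \<^bold>\<and> (y \<^bold>\<rightarrow> z) = x \<^bold>\<and> ((x \<^bold>\<and> y) \<^bold>\<rightarrow> (x \<^bold>\<and> z))"
    and imp_refl: "x \<in> carrier L \<Longrightarrow> x \<^bold>\<rightarrow> x = \<one>"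

locale heyting_algebra = semi_heyting_algebra +
  assumes meet_imp_one: "\<lbrakk>x \<in> carrier L; y \<in> carrier L\<rbrakk> \<Longrightarrow> (x \<^bold>\<and> y) \<^bold>\<rightarrow> y = \<one>"

locale dqd_algebra = semi_heyting_algebra +
  assumes prime_zero: "\<zero>\<acute> = \<one>"
    and prime_one: "\<one>\<acute> = \<zero>"
    and prime_meet: "\<lbrakk>x \<in> carrier L; y \<in> carrier L\<rbrakk> \<Longrightarrow> (x \<^bold>\<and> y)\<acute> = x\<acute> \<^bold>\<or> y\<acute>"
    and prime_prime_join: "\<lbrakk>x \<in> carrier L; y \<in> carrier L\<rbrakk> \<Longrightarrow> (x \<^bold>\<or> y)\<acute>\<acute> = x\<acute>\<acute> \<^bold>\<or> y\<acute>\<acute>"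
    and prime_prime_le: "x \<in> carrier L \<Longrightarrow> x\<acute>\<acute> \<^bold>\<and> x = x\<acute>\<acute>"

locale jidl1_algebra = dqd_algebra +
  assumes join_imp_distrib: "\<lbrakk>x \<in> carrier L; y \<in> carrier L; z \<in> carrier L\<rbrakk>
      \<Longrightarrow> x\<acute> \<^bold>\<or> (y \<^bold>\<rightarrow> z) = (x\<acute> \<^bold>\<or> y) \<^bold>\<rightarrow> (x\<acute> \<^bold>\<or> z)"
    and prelinear: "\<lbrakk>x \<in> carrier L; y \<in> carrier L\<rbrakk> \<Longrightarrow> (x \<^bold>\<rightarrow> y) \<^bold>\<or> (y \<^bold>\<rightarrow> x) = \<one>"
    and level_one: "x \<in> carrier L \<Longrightarrow> x \<^bold>\<and> x\<acute>\<star> = (x \<^bold>\<and> x\<acute>\<star>)\<acute>\<star>"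

locale dually_stone_heyting_chain = dqd_algebra + heyting_algebra +
  assumes dually_stone: "x \<in> carrier L \<Longrightarrow> x\<acute> \<^bold>\<and> x\<acute>\<acute> = \<zero>"
    and chain: "\<lbrakk>x \<in> carrier L; y \<in> carrier L\<rbrakk> \<Longrightarrow> x \<^bold>\<and> y = x \<or> x \<^bold>\<and> y = y"

section \<open>Varieties\<close>

datatype trm = Var nat | Join trm trm | Meet trm trm | Imp trm trm | Prime trm | Zero | One

type_synonym identity = "trm \<times> trm"

primrec eval :: "'a alg \<Rightarrow> (nat \<Rightarrow> 'a) \<Rightarrow> trm \<Rightarrow> 'a" where
  "eval L v (Var n) = v n"
| "eval L v (Join s t) = eval L v s \<^bold>\<or>\<^bsub>L\<^esub> eval L v t"
| "eval L v (Meet s t) = eval L v s \<^bold>\<and>\<^bsub>L\<^esub> eval L v t"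
| "eval L v (Imp s t) = eval L v s \<^bold>\<rightarrow>\<^bsub>L\<^esub> eval L v t"
| "eval L v (Prime s) = (eval L v s)\<acute>\<^bsub>L\<^esub>"
| "eval L v Zero = \<zero>\<^bsub>L\<^esub>"
| "eval L v One = \<one>\<^bsub>L\<^esub>"

definition satisfies :: "'a alg \<Rightarrow> identity \<Rightarrow> bool" where
  "satisfies L e \<longleftrightarrow> (\<forall>v. range v \<subseteq> carrier L \<longrightarrow> eval L v (fst e) = eval L v (snd e))"

text \<open>
  A class of algebras is rendered as a set of algebras whose carriers are subsets of a
  type \<open>'a\<close>. This loses nothing as long as \<open>'a\<close> is infinite: an identity involves only
  finitely many variables, so every variety is determined by its countable members. Over a
  finite type, however, large generators would be missing.
\<close>

definition models :: "identity set \<Rightarrow> 'a alg set" where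
  "models E = {L. algebra L \<and> (\<forall>e\<in>E. satisfies L e)}"

definition variety :: "'a alg set \<Rightarrow> bool" where
  "variety K \<longleftrightarrow> (\<exists>E. K = models E)"

definition generated_variety :: "'a alg set \<Rightarrow> 'a alg set" where
  "generated_variety K = \<Inter>{W. variety W \<and> K \<subseteq> W}"

definition DQD :: "'a alg set" where
  "DQD = {L. dqd_algebra L}"

definition subvarieties_DQD :: "'a alg set gorder" where
  "subvarieties_DQD = \<lparr>carrier = {W. variety W \<and> W \<subseteq> DQD}, eq = (=), le = (\<subseteq>)\<rparr>"

definition JIDL1 :: "'a alg set" where
  "JIDL1 = {L. jidl1_algebra L}"

definition DStHC :: "'a alg set" where
  "DStHC = generated_variety {L. dually_stone_heyting_chain L}"

text \<open>
  The algebra \<open>D\<^sub>2\<close> on four given distinct elements \<open>z\<close> (the bottom), \<open>a\<close>, \<open>b\<close> and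
  \<open>u\<close> (the top).
\<close>

definition compl4 :: "'a \<Rightarrow> 'a \<Rightarrow> 'a \<Rightarrow> 'a \<Rightarrow> 'a \<Rightarrow> 'a" where
  "compl4 z a b u x = (if x = z then u else if x = u then z else if x = a then b else a)"

definition join4 :: "'a \<Rightarrow> 'a \<Rightarrow> 'a \<Rightarrow> 'a \<Rightarrow> 'a \<Rightarrow> 'a \<Rightarrow> 'a" where
  "join4 z a b u x y = (if x = y \<or> y = z then x else if x = z then y else u)"

definition meet4 :: "'a \<Rightarrow> 'a \<Rightarrow> 'a \<Rightarrow> 'a \<Rightarrow> 'a \<Rightarrow> 'a \<Rightarrow> 'a" where
  "meet4 z a b u x y = (if x = y \<or> y = u then x else if x = u then y else z)"

definition D2 :: "'a \<Rightarrow> 'a \<Rightarrow> 'a \<Rightarrow> 'a \<Rightarrow> 'a alg" where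
  "D2 z a b u = \<lparr>carrier = {z, a, b, u},
     ljoin = join4 z a b u,
     lmeet = meet4 z a b u,
     limp = (\<lambda>x y. join4 z a b u (compl4 z a b u x) y),
     lprime = (\<lambda>x. if x = z then u else if x = u then z else x),
     lzero = z,
     lone = u\<rparr>"

end

theory Submission
  imports Defs
begin

text \<open>
  The identities defining \<open>JIDL\<^sub>1\<close> hold in all dually Stone Heyting chains and in \<open>D\<^sub>2\<close>, so one
  inclusion is immediate. For the other it suffices that every identity \<open>s \<approx> t\<close> failing in some
  \<open>L\<close> in \<open>JIDL\<^sub>1\<close> already fails in a quotient of \<open>L\<close> that is a dually Stone Heyting chain or
  embeds into \<open>D\<^sub>2\<close> (lemma \<open>jidl1_refutation\<close>).

  Prelinearity forces the semi-Heyting reduct of \<open>L\<close> to be a Heyting algebra, and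
  distributing \<open>x'\<close> over \<open>x' \<rightarrow> 0\<close> gives \<open>x' \<or> x'\<^sup>* = 1\<close>, so every \<open>x'\<close> is complemented.
  Call \<open>c = x \<and> x'\<^sup>*\<close> the core of \<open>x\<close>. The level-one identity says \<open>c = c'\<^sup>*\<close>; hence \<open>c'\<close> is the
  complement of \<open>c\<close>, and \<open>c'\<close> is fixed by \<open>y \<mapsto> y'\<^sup>*\<close> as well.

  Congruences come from normal filters, that is, filters closed under \<open>y \<mapsto> y'\<^sup>*\<close>. Suppose the
  two sides of the identity take distinct values \<open>s\<close> and \<open>t\<close>, and let \<open>F\<close> be a normal filter
  maximal among those omitting \<open>(s \<rightarrow> t) \<and> (t \<rightarrow> s)\<close>. For every core \<open>c\<close>, adjoining \<open>c\<close> or \<open>c'\<close>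
  to \<open>F\<close> yields a normal filter again; if neither were in \<open>F\<close>, both extensions would contain the
  omitted element, and since \<open>c \<or> c' = 1\<close>, so would \<open>F\<close>. Hence \<open>F\<close> contains \<open>c\<close> or \<open>c'\<close>
  (lemma \<open>separating_normal_filter\<close>). So in \<open>L/F\<close> the values stay distinct, and every core
  is \<open>0\<close> or \<open>1\<close>, the latter only for the element \<open>1\<close>.

  In such a quotient every \<open>x \<noteq> 1\<close> satisfies \<open>x \<le> x'\<close>, whence \<open>x = 1\<close>, \<open>x' = 1\<close> or \<open>x' = x\<close>
  (lemma \<open>trivial_core_cases\<close>). If no nonzero \<open>x\<close> satisfies \<open>x' = x\<close>, then \<open>1\<close> is join-irreducible
  and prelinearity gives a chain (lemma \<open>trivial_core_chain\<close>). If \<open>p' = p \<noteq> 0\<close>, then the only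
  elements are \<open>0\<close>, \<open>p\<close>, \<open>p\<^sup>*\<close> and \<open>1\<close>, and the quotient is \<open>D\<^sub>2\<close> (lemma \<open>trivial_core_four\<close>).
  Quotients are realised on representatives inside the carrier of \<open>L\<close>, so that they live in
  the same type.
\<close>

section \<open>Order and residuation\<close>

context algebra
begin

lemmas closed [simp, intro] =
  join_closed meet_closed imp_closed prime_closed zero_closed one_closed

lemma star_closed [simp, intro]: "x \<in> carrier L \<Longrightarrow> x\<star> \<in> carrier L"
  by (simp add: star_def)

end

context bounded_lattice_algebra
begin

text \<open>The lattice order, expressed through the meet.\<close>

definition leq :: "'a \<Rightarrow> 'a \<Rightarrow> bool" (infix \<open>\<preceq>\<close> 50) where
  "x \<preceq> y \<longleftrightarrow> x \<^bold>\<and> y = x"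

lemma meet_idem [simp]: "x \<in> carrier L \<Longrightarrow> x \<^bold>\<and> x = x"
  by (metis join_absorb meet_absorb meet_closed)

lemma join_idem [simp]: "x \<in> carrier L \<Longrightarrow> x \<^bold>\<or> x = x"
  by (metis join_absorb meet_idem)

lemma leq_refl [simp]: "x \<in> carrier L \<Longrightarrow> x \<preceq> x"
  by (simp add: leq_def)

lemma leq_antisym: "\<lbrakk>x \<preceq> y; y \<preceq> x; x \<in> carrier L; y \<in> carrier L\<rbrakk> \<Longrightarrow> x = y"
  by (metis leq_def meet_comm)

lemma leq_trans [trans]:
  "\<lbrakk>x \<preceq> y; y \<preceq> w; x \<in> carrier L; y \<in> carrier L; w \<in> carrier L\<rbrakk> \<Longrightarrow> x \<preceq> w"
  by (metis leq_def meet_assoc)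

lemma leq_iff_join: "\<lbrakk>x \<in> carrier L; y \<in> carrier L\<rbrakk> \<Longrightarrow> x \<preceq> y \<longleftrightarrow> x \<^bold>\<or> y = y"
  by (metis join_absorb join_comm leq_def meet_absorb meet_comm)

lemma meet_leq1 [simp]: "\<lbrakk>x \<in> carrier L; y \<in> carrier L\<rbrakk> \<Longrightarrow> x \<^bold>\<and> y \<preceq> x"
  by (metis leq_def meet_assoc meet_comm meet_idem)

lemma meet_leq2 [simp]: "\<lbrakk>x \<in> carrier L; y \<in> carrier L\<rbrakk> \<Longrightarrow> x \<^bold>\<and> y \<preceq> y"
  by (metis meet_comm meet_leq1)

lemma leq_meet_iff:
  "\<lbrakk>x \<in> carrier L; y \<in> carrier L; w \<in> carrier L\<rbrakk> \<Longrightarrow> w \<preceq> x \<^bold>\<and> y \<longleftrightarrow> w \<preceq> x \<and> w \<preceq> y"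
  by (metis leq_def leq_trans meet_assoc meet_closed meet_leq1 meet_leq2)

lemma join_geq1 [simp]: "\<lbrakk>x \<in> carrier L; y \<in> carrier L\<rbrakk> \<Longrightarrow> x \<preceq> x \<^bold>\<or> y"
  by (simp add: leq_def meet_absorb)

lemma join_geq2 [simp]: "\<lbrakk>x \<in> carrier L; y \<in> carrier L\<rbrakk> \<Longrightarrow> y \<preceq> x \<^bold>\<or> y"
  by (metis join_comm join_geq1)

lemma join_leq_iff:
  "\<lbrakk>x \<in> carrier L; y \<in> carrier L; w \<in> carrier L\<rbrakk> \<Longrightarrow> x \<^bold>\<or> y \<preceq> w \<longleftrightarrow> x \<preceq> w \<and> y \<preceq> w"
  by (metis join_assoc join_closed join_geq1 join_geq2 leq_iff_join leq_trans)

lemma meet_leqI1: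
  "\<lbrakk>x \<preceq> w; x \<in> carrier L; y \<in> carrier L; w \<in> carrier L\<rbrakk> \<Longrightarrow> x \<^bold>\<and> y \<preceq> w"
  by (rule leq_trans [OF meet_leq1]) simp_all

lemma meet_leqI2:
  "\<lbrakk>y \<preceq> w; x \<in> carrier L; y \<in> carrier L; w \<in> carrier L\<rbrakk> \<Longrightarrow> x \<^bold>\<and> y \<preceq> w"
  by (rule leq_trans [OF meet_leq2]) simp_all

lemma leq_joinI1:
  "\<lbrakk>w \<preceq> x; x \<in> carrier L; y \<in> carrier L; w \<in> carrier L\<rbrakk> \<Longrightarrow> w \<preceq> x \<^bold>\<or> y"
  by (rule leq_trans [OF _ join_geq1]) simp_all

lemma zero_leq [simp]: "x \<in> carrier L \<Longrightarrow> \<zero> \<preceq> x"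
  by (simp add: leq_def zero_least)

lemma leq_one [simp]: "x \<in> carrier L \<Longrightarrow> x \<preceq> \<one>"
  by (simp add: leq_def one_greatest)

lemma leq_zero_iff: "x \<in> carrier L \<Longrightarrow> x \<preceq> \<zero> \<longleftrightarrow> x = \<zero>"
  using leq_antisym by force

lemma one_leq_iff: "x \<in> carrier L \<Longrightarrow> \<one> \<preceq> x \<longleftrightarrow> x = \<one>"
  using leq_antisym by force

lemma bounds [simp]:
  assumes "x \<in> carrier L"
  shows "\<zero> \<^bold>\<and> x = \<zero>" "x \<^bold>\<and> \<zero> = \<zero>" "\<one> \<^bold>\<and> x = x" "x \<^bold>\<and> \<one> = x"
    "\<zero> \<^bold>\<or> x = x" "x \<^bold>\<or> \<zero> = x" "\<one> \<^bold>\<or> x = \<one>" "x \<^bold>\<or> \<one> = \<one>"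
  using assms zero_least [of x] one_greatest [of x] leq_iff_join [of \<zero> x] leq_iff_join [of x \<one>]
  by (simp_all add: meet_comm [of x \<zero>] meet_comm [of \<one> x] join_comm [of x \<zero>]
      join_comm [of \<one> x])

end

context heyting_algebra
begin

lemma imp_eq_one: "\<lbrakk>x \<preceq> y; x \<in> carrier L; y \<in> carrier L\<rbrakk> \<Longrightarrow> x \<^bold>\<rightarrow> y = \<one>"
  by (metis leq_def meet_imp_one)

lemma leq_imp_iff:
  assumes [simp]: "x \<in> carrier L" "y \<in> carrier L" "w \<in> carrier L"
  shows "w \<preceq> x \<^bold>\<rightarrow> y \<longleftrightarrow> w \<^bold>\<and> x \<preceq> y"
proof
  assume "w \<preceq> x \<^bold>\<rightarrow> y"
  then have "w \<^bold>\<and> x \<preceq> x \<^bold>\<and> (x \<^bold>\<rightarrow> y)"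
    by (simp add: leq_meet_iff meet_leqI1)
  then show "w \<^bold>\<and> x \<preceq> y"
    by (simp add: meet_imp leq_meet_iff)
next
  assume "w \<^bold>\<and> x \<preceq> y"
  then have "w \<^bold>\<and> x \<preceq> w \<^bold>\<and> y"
    by (simp add: leq_meet_iff)
  then have "w \<^bold>\<and> (x \<^bold>\<rightarrow> y) = w"
    by (simp add: meet_imp_distrib [of w x y] imp_eq_one)
  then show "w \<preceq> x \<^bold>\<rightarrow> y"
    by (simp add: leq_def)
qed

lemma imp_eq_one_iff: "\<lbrakk>x \<in> carrier L; y \<in> carrier L\<rbrakk> \<Longrightarrow> x \<^bold>\<rightarrow> y = \<one> \<longleftrightarrow> x \<preceq> y"
  by (metis bounds(3) leq_imp_iff one_closed one_leq_iff imp_closed)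

lemma leq_star_iff: "\<lbrakk>x \<in> carrier L; w \<in> carrier L\<rbrakk> \<Longrightarrow> w \<preceq> x\<star> \<longleftrightarrow> w \<^bold>\<and> x = \<zero>"
  by (simp add: star_def leq_imp_iff leq_zero_iff)

lemma star_bounds [simp]: "\<zero>\<star> = \<one>" "\<one>\<star> = \<zero>"
  by (simp_all add: star_def imp_refl)
    (metis bounds(3) imp_closed meet_imp one_closed zero_closed)

lemma meet_star [simp]: "x \<in> carrier L \<Longrightarrow> x \<^bold>\<and> x\<star> = \<zero>"
  by (simp add: star_def meet_imp)

lemma star_antimono:
  "\<lbrakk>x \<preceq> y; x \<in> carrier L; y \<in> carrier L\<rbrakk> \<Longrightarrow> y\<star> \<preceq> x\<star>"
  by (metis bounds(2) leq_def leq_star_iff meet_assoc meet_comm meet_star star_closed)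

lemma meet_join_distrib:
  assumes [simp]: "x \<in> carrier L" "y \<in> carrier L" "w \<in> carrier L"
  shows "x \<^bold>\<and> (y \<^bold>\<or> w) = (x \<^bold>\<and> y) \<^bold>\<or> (x \<^bold>\<and> w)" (is "_ = ?R")
proof (rule leq_antisym)
  have "y \<preceq> x \<^bold>\<rightarrow> ?R" "w \<preceq> x \<^bold>\<rightarrow> ?R"
    by (simp_all add: leq_imp_iff meet_comm [of _ x])
  then have "y \<^bold>\<or> w \<preceq> x \<^bold>\<rightarrow> ?R"
    by (simp add: join_leq_iff)
  then show "x \<^bold>\<and> (y \<^bold>\<or> w) \<preceq> ?R"
    by (simp add: leq_imp_iff meet_comm [of _ x])
  show "?R \<preceq> x \<^bold>\<and> (y \<^bold>\<or> w)"
    by (simp add: join_leq_iff leq_meet_iff meet_leqI2)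
qed simp_all

lemma star_unique:
  assumes [simp]: "x \<in> carrier L" "y \<in> carrier L"
    and "x \<^bold>\<and> y = \<zero>" "x \<^bold>\<or> y = \<one>"
  shows "x\<star> = y"
proof (rule leq_antisym)
  have "x\<star> = x\<star> \<^bold>\<and> (x \<^bold>\<or> y)"
    by (simp add: assms)
  also have "\<dots> = x\<star> \<^bold>\<and> y"
    by (simp add: meet_join_distrib meet_comm [of "x\<star>" x])
  finally show "x\<star> \<preceq> y"
    by (simp add: leq_def)
  show "y \<preceq> x\<star>"
    by (simp add: leq_star_iff assms meet_comm [of y x])
qed simp_all

text \<open>Implication out of a complemented element is Boolean.\<close>

lemma complemented_imp:
  assumes [simp]: "x \<in> carrier L" "y \<in> carrier L" "w \<in> carrier L"
    and "x \<^bold>\<and> y = \<zero>" "x \<^bold>\<or> y = \<one>"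
  shows "x \<^bold>\<rightarrow> w = y \<^bold>\<or> w"
proof (rule leq_antisym)
  have "x \<^bold>\<rightarrow> w = (x \<^bold>\<rightarrow> w) \<^bold>\<and> (x \<^bold>\<or> y)"
    by (simp add: assms)
  also have "\<dots> = (x \<^bold>\<and> w) \<^bold>\<or> ((x \<^bold>\<rightarrow> w) \<^bold>\<and> y)"
    by (simp add: meet_join_distrib meet_comm [of "x \<^bold>\<rightarrow> w" x] meet_imp)
  also have "\<dots> \<preceq> y \<^bold>\<or> w"
    by (simp add: join_leq_iff meet_leqI2 leq_joinI1)
  finally show "x \<^bold>\<rightarrow> w \<preceq> y \<^bold>\<or> w" .
  show "y \<^bold>\<or> w \<preceq> x \<^bold>\<rightarrow> w"
    by (simp add: leq_imp_iff meet_comm [of "y \<^bold>\<or> w" x] meet_join_distrib assms(4))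
qed simp_all

end

context dqd_algebra
begin

lemma prime_antimono:
  "\<lbrakk>x \<preceq> y; x \<in> carrier L; y \<in> carrier L\<rbrakk> \<Longrightarrow> y\<acute> \<preceq> x\<acute>"
  by (metis join_geq2 leq_def prime_closed prime_meet)

lemma prime_prime_leq: "x \<in> carrier L \<Longrightarrow> x\<acute>\<acute> \<preceq> x"
  by (simp add: leq_def prime_prime_le)

lemma prime_prime_prime: "x \<in> carrier L \<Longrightarrow> x\<acute>\<acute>\<acute> = x\<acute>"
  by (meson leq_antisym prime_antimono prime_closed prime_prime_leq)

end

section \<open>Consequences of the identities of JIDL1\<close>

context jidl1_algebra
begin

text \<open>Prelinearity alone makes a semi-Heyting algebra a Heyting algebra.\<close>

lemma heyting: "heyting_algebra L"
proof unfold_locales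
  fix x y
  assume [simp]: "x \<in> carrier L" "y \<in> carrier L"
  define c where "c = y \<^bold>\<rightarrow> (x \<^bold>\<and> y)"
  define d where "d = (x \<^bold>\<and> y) \<^bold>\<rightarrow> y"
  have [simp]: "c \<in> carrier L" "d \<in> carrier L"
    by (simp_all add: c_def d_def)
  have "y \<^bold>\<and> c = x \<^bold>\<and> y"
    unfolding c_def by (simp add: meet_imp) (metis \<open>x \<in> _\<close> \<open>y \<in> _\<close> leq_def meet_closed meet_comm meet_leq2)
  then have "c \<^bold>\<and> y = x \<^bold>\<and> y" "c \<^bold>\<and> (x \<^bold>\<and> y) = x \<^bold>\<and> y"
    by (metis \<open>c \<in> _\<close> \<open>y \<in> _\<close> meet_assoc meet_comm meet_idem)+
  \<comment> \<open>Modulo the filter generated by \<open>c\<close> the elements \<open>x \<and> y\<close> and \<open>y\<close> coincide.\<close>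
  then have "c \<^bold>\<and> d = c"
    unfolding d_def by (simp add: meet_imp_distrib [of c] imp_refl)
  then have "c \<preceq> d"
    by (simp add: leq_def)
  moreover have "d \<^bold>\<or> c = \<one>"
    unfolding c_def d_def by (simp add: prelinear)
  ultimately show "(x \<^bold>\<and> y) \<^bold>\<rightarrow> y = \<one>"
    by (metis \<open>c \<in> _\<close> \<open>d \<in> _\<close> d_def join_comm leq_iff_join)
qed

end

sublocale jidl1_algebra \<subseteq> heyting_algebra
  by (rule heyting)

context jidl1_algebra
begin

text \<open>
  Distributing \<open>x'\<close> over \<open>x' \<rightarrow> 0\<close> yields \<open>x' \<or> x'\<^sup>* = (x' \<or> x') \<rightarrow> (x' \<or> 0) = x' \<rightarrow> x'\<close>.
\<close>

lemma prime_complemented: "x \<in> carrier L \<Longrightarrow> x\<acute> \<^bold>\<or> x\<acute>\<star> = \<one>"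
  using join_imp_distrib [of x "x\<acute>" \<zero>] by (simp add: star_def imp_refl)

lemma star_star_prime: "x \<in> carrier L \<Longrightarrow> x\<acute>\<star>\<star> = x\<acute>"
  by (rule star_unique) (simp_all add: prime_complemented join_comm meet_comm [of "x\<acute>\<star>"])

text \<open>The core of \<open>x\<close>: the generator of the normal filter generated by \<open>x\<close>.\<close>

definition core :: "'a \<Rightarrow> 'a" where
  "core x = x \<^bold>\<and> x\<acute>\<star>"

lemma core_closed [simp]: "x \<in> carrier L \<Longrightarrow> core x \<in> carrier L"
  by (simp add: core_def)

lemma core_leq: "x \<in> carrier L \<Longrightarrow> core x \<preceq> x"
  by (simp add: core_def)

lemma star_prime_core: "x \<in> carrier L \<Longrightarrow> (core x)\<acute>\<star> = core x"
  using level_one [of x] by (simp add: core_def)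

lemma core_complement:
  assumes [simp]: "x \<in> carrier L"
  shows "core x \<^bold>\<and> (core x)\<acute> = \<zero>" "core x \<^bold>\<or> (core x)\<acute> = \<one>"
  using meet_star [of "(core x)\<acute>"] prime_complemented [of "core x"]
  by (simp_all add: star_prime_core meet_comm join_comm)

text \<open>
  Both \<open>c\<close> and \<open>c'\<close> are thus fixed by \<open>y \<mapsto> y'\<^sup>*\<close> when \<open>c\<close> is a core, so each of them can be
  adjoined to a normal filter.
\<close>

lemma star_prime_prime_core:
  assumes [simp]: "x \<in> carrier L"
  shows "(core x)\<acute>\<acute>\<star> = (core x)\<acute>"
proof -
  let ?c = "core x"
  have "?c\<acute> \<^bold>\<or> ?c\<acute>\<acute> = (?c \<^bold>\<and> ?c\<acute>)\<acute>"
    by (simp add: prime_meet)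
  also have "\<dots> = \<one>"
    by (simp add: core_complement prime_zero)
  finally have j: "?c\<acute> \<^bold>\<or> ?c\<acute>\<acute> = \<one>" .
  have "?c\<acute>\<acute> \<^bold>\<and> ?c\<acute> \<preceq> ?c \<^bold>\<and> ?c\<acute>"
    by (simp add: leq_meet_iff meet_leqI1 prime_prime_leq)
  then have "?c\<acute>\<acute> \<^bold>\<and> ?c\<acute> = \<zero>"
    by (simp add: core_complement leq_zero_iff)
  with j show ?thesis
    by (intro star_unique) (simp_all add: join_comm)
qed

end

section \<open>Algebras with only trivial cores\<close>

text \<open>Homomorphisms between algebras, constrained on the carrier only.\<close>

definition alg_hom :: "('a \<Rightarrow> 'b) \<Rightarrow> 'a alg \<Rightarrow> 'b alg \<Rightarrow> bool" where
  "alg_hom h L M \<longleftrightarrow>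
    (\<forall>x\<in>carrier L. h x \<in> carrier M \<and> h (x\<acute>\<^bsub>L\<^esub>) = (h x)\<acute>\<^bsub>M\<^esub>) \<and>
    (\<forall>x\<in>carrier L. \<forall>y\<in>carrier L.
      h (x \<^bold>\<or>\<^bsub>L\<^esub> y) = h x \<^bold>\<or>\<^bsub>M\<^esub> h y \<and>
      h (x \<^bold>\<and>\<^bsub>L\<^esub> y) = h x \<^bold>\<and>\<^bsub>M\<^esub> h y \<and>
      h (x \<^bold>\<rightarrow>\<^bsub>L\<^esub> y) = h x \<^bold>\<rightarrow>\<^bsub>M\<^esub> h y) \<and>
    h \<zero>\<^bsub>L\<^esub> = \<zero>\<^bsub>M\<^esub> \<and> h \<one>\<^bsub>L\<^esub> = \<one>\<^bsub>M\<^esub>"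

context jidl1_algebra
begin

text \<open>
  If the core of \<open>y \<noteq> 1\<close> is \<open>0\<close>, then \<open>y \<le> y'\<^sup>*\<^sup>* = y'\<close>. Applied to \<open>x\<close> and \<open>x'\<close> this gives
  \<open>x \<le> x' \<le> x'' \<le> x\<close> unless \<open>x\<close> or \<open>x'\<close> is \<open>1\<close>.
\<close>

lemma trivial_core_cases:
  assumes "\<And>x. x \<in> carrier L \<Longrightarrow> x \<noteq> \<one> \<Longrightarrow> core x = \<zero>"
    and [simp]: "x \<in> carrier L"
  shows "x = \<one> \<or> x\<acute> = \<one> \<or> x\<acute> = x"
proof -
  have below: "y \<preceq> y\<acute>" if "y \<in> carrier L" "y \<noteq> \<one>" for y
  proof -
    have "y \<preceq> y\<acute>\<star>\<star>"
      using assms(1) [OF that] that(1) by (simp add: leq_star_iff core_def)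
    then show ?thesis
      using that(1) by (simp add: star_star_prime)
  qed
  show ?thesis
  proof (cases "x = \<one> \<or> x\<acute> = \<one>")
    case False
    then have "x \<preceq> x\<acute>" "x\<acute> \<preceq> x\<acute>\<acute>"
      by (simp_all add: below)
    moreover have "x\<acute> \<preceq> x"
      by (rule leq_trans [OF \<open>x\<acute> \<preceq> x\<acute>\<acute>\<close> prime_prime_leq]) simp_all
    ultimately show ?thesis
      by (simp add: leq_antisym)
  qed auto
qed

text \<open>
  If \<open>v' = w' = 1\<close> then \<open>(v \<or> w)'' = 0\<close>; so \<open>1\<close> is join-irreducible, and prelinearity then
  makes any two elements comparable.
\<close>

lemma trivial_core_chain:
  assumes cases: "\<And>x. x \<in> carrier L \<Longrightarrow> x = \<one> \<or> x\<acute> = \<one>"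
  shows "dually_stone_heyting_chain L"
proof unfold_locales
  fix x assume x: "x \<in> carrier L"
  then show "x\<acute> \<^bold>\<and> x\<acute>\<acute> = \<zero>"
    using cases [OF x] by (auto simp: prime_one prime_zero)
next
  fix x y assume [simp]: "x \<in> carrier L" "y \<in> carrier L"
  have irreducible: "v = \<one> \<or> w = \<one>"
    if "v \<^bold>\<or> w = \<one>" and [simp]: "v \<in> carrier L" "w \<in> carrier L" for v w
  proof (rule ccontr)
    assume "\<not> (v = \<one> \<or> w = \<one>)"
    then have "v\<acute> = \<one>" "w\<acute> = \<one>"
      using cases [of v] cases [of w] by auto
    then have "(v \<^bold>\<or> w)\<acute>\<acute> = \<zero>"
      by (simp add: prime_prime_join prime_one)
    then have "\<one> = \<zero>"
      by (simp add: that(1) prime_one prime_zero)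
    then have "v = \<one>"
      by (metis bounds(1,3) that(2))
    with \<open>\<not> (v = \<one> \<or> w = \<one>)\<close> show False
      by simp
  qed
  have "x \<preceq> y \<or> y \<preceq> x"
    using irreducible [OF prelinear [of x y]] by (simp add: imp_eq_one_iff)
  then show "x \<^bold>\<and> y = x \<or> x \<^bold>\<and> y = y"
    by (auto simp: leq_def meet_comm)
qed

lemma trivial_core_four:
  assumes cases: "\<And>x. x \<in> carrier L \<Longrightarrow> x = \<one> \<or> x\<acute> = \<one> \<or> x\<acute> = x"
    and [simp]: "p \<in> carrier L" and fixp: "p\<acute> = p" and "p \<noteq> \<zero>"
  obtains q where "carrier L = {\<zero>, p, q, \<one>}" "distinct [\<zero>, p, q, \<one>]"
    "p \<^bold>\<and> q = \<zero>" "p \<^bold>\<or> q = \<one>" "q\<acute> = q"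
proof -
  define q where "q = p\<star>"
  have [simp]: "q \<in> carrier L"
    by (simp add: q_def)
  have meet: "p \<^bold>\<and> q = \<zero>" and join: "p \<^bold>\<or> q = \<one>"
    using prime_complemented [of p] by (simp_all add: q_def fixp)
  have "p \<noteq> \<one>"
    using \<open>p \<noteq> \<zero>\<close> fixp prime_one by metis
  then have "\<one> \<noteq> \<zero>"
    by (metis bounds(1,3) assms(2))
  have "q \<noteq> \<zero>"
    using join \<open>p \<noteq> \<one>\<close> by auto
  have "q \<noteq> \<one>"
    using meet \<open>p \<noteq> \<zero>\<close> by auto
  have "p \<noteq> q"
    using meet \<open>p \<noteq> \<zero>\<close> by auto
  have "p \<^bold>\<or> q\<acute>\<acute> = \<one>"
    using prime_prime_join [of p q] by (simp add: join fixp prime_one prime_zero)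
  then have "q\<acute> \<noteq> \<one>"
    using \<open>p \<noteq> \<one>\<close> by (auto simp: prime_one)
  then have fixq: "q\<acute> = q"
    using cases [of q] \<open>q \<noteq> \<one>\<close> by simp
  \<comment> \<open>Since \<open>(x \<or> e)'' = e\<close> is neither \<open>0\<close> nor \<open>1\<close>, the join \<open>x \<or> e\<close> is fixed by \<open>'\<close> and equals \<open>e\<close>.\<close>
  have below: "x \<preceq> e"
    if "x\<acute> = \<one>" "e\<acute> = e" "e \<noteq> \<zero>" "e \<noteq> \<one>" and [simp]: "x \<in> carrier L" "e \<in> carrier L" for x e
  proof -
    have e: "(x \<^bold>\<or> e)\<acute>\<acute> = e"
      by (simp add: prime_prime_join that prime_one)
    have "x \<^bold>\<or> e \<noteq> \<one>"
      using e \<open>e \<noteq> \<one>\<close> by (auto simp: prime_one prime_zero)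
    moreover have "(x \<^bold>\<or> e)\<acute> \<noteq> \<one>"
      using e \<open>e \<noteq> \<zero>\<close> by (auto simp: prime_one)
    ultimately have "x \<^bold>\<or> e = e"
      using cases [of "x \<^bold>\<or> e"] e by auto
    then show ?thesis
      by (simp add: leq_iff_join)
  qed
  have small: "x = \<zero>" if "x\<acute> = \<one>" and [simp]: "x \<in> carrier L" for x
  proof -
    have "x \<preceq> p" "x \<preceq> q"
      using below that fixp fixq \<open>p \<noteq> \<zero>\<close> \<open>p \<noteq> \<one>\<close> \<open>q \<noteq> \<zero>\<close> \<open>q \<noteq> \<one>\<close> by auto
    then have "x \<preceq> \<zero>"
      using leq_meet_iff [of p q x] by (simp add: meet)
    then show ?thesis
      by (simp add: leq_zero_iff)
  qed
  \<comment> \<open>Here \<open>(p \<and> x)' = p \<or> x\<close>, so the trichotomy for \<open>p \<and> x\<close> leaves complements or equality.\<close>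
  have "x = p \<or> x = q" if "x\<acute> = x" and [simp]: "x \<in> carrier L" for x
  proof -
    have m: "(p \<^bold>\<and> x)\<acute> = p \<^bold>\<or> x"
      by (simp add: prime_meet that fixp)
    have "p \<^bold>\<and> x \<noteq> \<one>"
      using \<open>p \<noteq> \<one>\<close> by (metis assms(2) meet_leq1 one_leq_iff that(2))
    then consider "p \<^bold>\<and> x = \<zero>" "p \<^bold>\<or> x = \<one>" | "p \<^bold>\<or> x = p \<^bold>\<and> x"
      using cases [of "p \<^bold>\<and> x"] small [of "p \<^bold>\<and> x"] m by auto
    then show ?thesis
    proof cases
      case 1
      then have "p\<star> = x"
        by (simp add: star_unique)
      then show ?thesis
        by (simp add: q_def)
    next
      case 2
      then have "p = x"
        by (metis assms(2) join_geq1 join_geq2 leq_antisym leq_meet_iff meet_closed that(2))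
      then show ?thesis
        by simp
    qed
  qed
  then have "carrier L = {\<zero>, p, q, \<one>}"
    using cases small by auto
  moreover have "distinct [\<zero>, p, q, \<one>]"
    using \<open>p \<noteq> \<zero>\<close> \<open>p \<noteq> \<one>\<close> \<open>q \<noteq> \<zero>\<close> \<open>q \<noteq> \<one>\<close> \<open>p \<noteq> q\<close> \<open>\<one> \<noteq> \<zero>\<close> by auto
  ultimately show ?thesis
    using that meet join fixq by blast
qed

lemma trivial_core_embeds_D2:
  assumes cases: "\<And>x. x \<in> carrier L \<Longrightarrow> x = \<one> \<or> x\<acute> = \<one> \<or> x\<acute> = x"
    and "p \<in> carrier L" "p\<acute> = p" "p \<noteq> \<zero>"
    and "distinct [z, a, b, u]"
  obtains h where "alg_hom h L (D2 z a b u)" "inj_on h (carrier L)"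
proof -
  from trivial_core_four [OF cases assms(2-4)] obtain q
    where car: "carrier L = {\<zero>, p, q, \<one>}" and dist: "distinct [\<zero>, p, q, \<one>]"
      and meet: "p \<^bold>\<and> q = \<zero>" and join: "p \<^bold>\<or> q = \<one>" and q: "q\<acute> = q"
    by blast
  have in_car [simp]: "p \<in> carrier L" "q \<in> carrier L"
    by (auto simp: car)
  have imp: "\<zero> \<^bold>\<rightarrow> w = \<one>" "p \<^bold>\<rightarrow> w = q \<^bold>\<or> w" "q \<^bold>\<rightarrow> w = p \<^bold>\<or> w" "\<one> \<^bold>\<rightarrow> w = w"
    if w: "w \<in> carrier L" for w
    using w complemented_imp [of p q w] complemented_imp [of q p w] complemented_imp [of \<zero> \<one> w]
      complemented_imp [of \<one> \<zero> w] meet join meet_comm [of p q] join_comm [of p q]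
    by simp_all
  note tables = meet join meet_comm [of q p] join_comm [of q p] bounds imp assms(3) q
    prime_zero prime_one
  define h where "h x = (if x = \<zero> then z else if x = p then a else if x = q then b else u)" for x
  have h: "h \<zero> = z" "h p = a" "h q = b" "h \<one> = u"
    using dist by (auto simp: h_def)
  have "alg_hom h L (D2 z a b u)"
    unfolding alg_hom_def ball_simps car
    using assms(5) dist
    by (simp add: tables h D2_def join4_def meet4_def compl4_def; force)
  moreover have "inj_on h (carrier L)"
    using assms(5) dist by (auto simp: car inj_on_def h)
  ultimately show ?thesis
    using that by blast
qed

end


section \<open>Quotients by normal filters\<close>

context jidl1_algebra
begin

text \<open>A lattice filter closed under \<open>x \<mapsto> x'\<^sup>*\<close>.\<close>

definition normal_filter :: "'a set \<Rightarrow> bool" where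
  "normal_filter F \<longleftrightarrow> F \<subseteq> carrier L \<and> \<one> \<in> F \<and> (\<forall>x\<in>F. \<forall>y\<in>F. x \<^bold>\<and> y \<in> F) \<and>
    (\<forall>x\<in>F. \<forall>y\<in>carrier L. x \<preceq> y \<longrightarrow> y \<in> F) \<and> (\<forall>x\<in>F. x\<acute>\<star> \<in> F)"

lemma normal_filterD:
  assumes "normal_filter F"
  shows "x \<in> F \<Longrightarrow> x \<in> carrier L" "\<one> \<in> F" "\<lbrakk>x \<in> F; y \<in> F\<rbrakk> \<Longrightarrow> x \<^bold>\<and> y \<in> F"
    "\<lbrakk>x \<preceq> y; x \<in> F; y \<in> carrier L\<rbrakk> \<Longrightarrow> y \<in> F" "x \<in> F \<Longrightarrow> x\<acute>\<star> \<in> F"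
  using assms unfolding normal_filter_def by blast+

lemma meet_star_leq:
  assumes [simp]: "x \<in> carrier L" "y \<in> carrier L"
  shows "x\<star> \<^bold>\<and> y\<star> \<preceq> (x \<^bold>\<or> y)\<star>"
proof -
  have "(x\<star> \<^bold>\<and> y\<star>) \<^bold>\<and> x \<preceq> x\<star> \<^bold>\<and> x" "(x\<star> \<^bold>\<and> y\<star>) \<^bold>\<and> y \<preceq> y\<star> \<^bold>\<and> y"
    by (simp_all add: leq_meet_iff meet_leqI1)
  then have "(x\<star> \<^bold>\<and> y\<star>) \<^bold>\<and> x = \<zero>" "(x\<star> \<^bold>\<and> y\<star>) \<^bold>\<and> y = \<zero>"
    by (simp_all add: meet_comm [of _ x] meet_comm [of _ y] leq_zero_iff)
  then show ?thesis
    by (simp add: leq_star_iff meet_join_distrib)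
qed

text \<open>
  The filter generated by a normal filter and an element fixed by \<open>x \<mapsto> x'\<^sup>*\<close> is normal:
  from \<open>f \<and> c \<le> x\<close> follows \<open>f'\<^sup>* \<and> c = f'\<^sup>* \<and> c'\<^sup>* \<le> (f' \<or> c')\<^sup>* = (f \<and> c)'\<^sup>* \<le> x'\<^sup>*\<close>.
\<close>

lemma normal_filter_adjoin:
  assumes F: "normal_filter F" and [simp]: "c \<in> carrier L" and c: "c\<acute>\<star> = c"
  shows "normal_filter {y \<in> carrier L. \<exists>f\<in>F. f \<^bold>\<and> c \<preceq> y}" (is "normal_filter ?G")
  unfolding normal_filter_def
proof (intro conjI ballI impI)
  note [simp] = normal_filterD(1) [OF F]
  show "?G \<subseteq> carrier L"
    by auto
  show "\<one> \<in> ?G"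
    using normal_filterD(2) [OF F] by auto
  fix x assume "x \<in> ?G"
  then obtain f where [simp]: "x \<in> carrier L" "f \<in> F" and f: "f \<^bold>\<and> c \<preceq> x"
    by auto
  show "x \<^bold>\<and> y \<in> ?G" if "y \<in> ?G" for y
  proof -
    from that obtain g where [simp]: "y \<in> carrier L" "g \<in> F" and g: "g \<^bold>\<and> c \<preceq> y"
      by auto
    have "(f \<^bold>\<and> g) \<^bold>\<and> c \<preceq> f \<^bold>\<and> c" "(f \<^bold>\<and> g) \<^bold>\<and> c \<preceq> g \<^bold>\<and> c"
      by (simp_all add: leq_meet_iff meet_leqI1)
    then have "(f \<^bold>\<and> g) \<^bold>\<and> c \<preceq> x \<^bold>\<and> y"
      using leq_trans [OF _ f, of "(f \<^bold>\<and> g) \<^bold>\<and> c"] leq_trans [OF _ g, of "(f \<^bold>\<and> g) \<^bold>\<and> c"]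
      by (simp add: leq_meet_iff)
    moreover have "f \<^bold>\<and> g \<in> F"
      using normal_filterD(3) [OF F] by simp
    ultimately show ?thesis
      by auto
  qed
  show "y \<in> ?G" if "y \<in> carrier L" "x \<preceq> y" for y
    using leq_trans [OF f that(2)] that(1) by auto
  have "f\<acute>\<star> \<^bold>\<and> c \<preceq> (f\<acute> \<^bold>\<or> c\<acute>)\<star>"
    using meet_star_leq [of "f\<acute>" "c\<acute>"] by (simp add: c)
  also have "f\<acute> \<^bold>\<or> c\<acute> = (f \<^bold>\<and> c)\<acute>"
    by (simp add: prime_meet)
  also have "(f \<^bold>\<and> c)\<acute>\<star> \<preceq> x\<acute>\<star>"
    using f by (intro star_antimono prime_antimono) simp_all
  finally have "f\<acute>\<star> \<^bold>\<and> c \<preceq> x\<acute>\<star>"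
    by simp
  moreover have "f\<acute>\<star> \<in> F"
    using normal_filterD(5) [OF F] by simp
  ultimately show "x\<acute>\<star> \<in> ?G"
    by auto
qed

text \<open>A normal filter that is maximal among those omitting \<open>d\<close> decides every core.\<close>

lemma separating_normal_filter:
  assumes [simp]: "d \<in> carrier L" and "d \<noteq> \<one>"
  obtains F where "normal_filter F" "d \<notin> F"
    "\<And>x. x \<in> carrier L \<Longrightarrow> core x \<in> F \<or> (core x)\<acute> \<in> F"
proof -
  let ?A = "{F. normal_filter F \<and> d \<notin> F}"
  have "{\<one>} \<in> ?A"
    using \<open>d \<noteq> \<one>\<close> by (auto simp: normal_filter_def one_leq_iff prime_one)
  then have "?A \<noteq> {}"
    by blast
  moreover have "\<Union>C \<in> ?A" if "C \<noteq> {}" and C: "subset.chain ?A C" for C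
  proof -
    have nf: "normal_filter F" "d \<notin> F" if "F \<in> C" for F
      using that C by (auto simp: subset.chain_def)
    have "x \<^bold>\<and> y \<in> \<Union>C" if "x \<in> \<Union>C" "y \<in> \<Union>C" for x y
    proof -
      from that obtain F G where "F \<in> C" "x \<in> F" "G \<in> C" "y \<in> G"
        by auto
      moreover from this have "F \<subseteq> G \<or> G \<subseteq> F"
        using C by (auto simp: subset_chain_def)
      ultimately show ?thesis
        using normal_filterD(3) [OF nf(1)] by (meson UnionI subsetD)
    qed
    moreover have "\<one> \<in> \<Union>C"
      using \<open>C \<noteq> {}\<close> normal_filterD(2) [OF nf(1)] by blast
    moreover have "\<Union>C \<subseteq> carrier L"
      using normal_filterD(1) [OF nf(1)] by blast
    moreover have "y \<in> \<Union>C" if "x \<in> \<Union>C" "y \<in> carrier L" "x \<preceq> y" for x y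
      using that normal_filterD(4) [OF nf(1)] by blast
    moreover have "x\<acute>\<star> \<in> \<Union>C" if "x \<in> \<Union>C" for x
      using that normal_filterD(5) [OF nf(1)] by blast
    ultimately show ?thesis
      using nf(2) by (auto simp: normal_filter_def)
  qed
  ultimately obtain F where F: "normal_filter F" "d \<notin> F"
    and max: "\<And>G. normal_filter G \<Longrightarrow> d \<notin> G \<Longrightarrow> F \<subseteq> G \<Longrightarrow> G = F"
    using subset_Zorn_nonempty [of ?A] by auto
  note [simp] = normal_filterD(1) [OF F(1)]
  have adjoin: "\<exists>f\<in>F. f \<^bold>\<and> c \<preceq> d" if [simp]: "c \<in> carrier L" and "c\<acute>\<star> = c" "c \<notin> F" for c
  proof -
    let ?G = "{y \<in> carrier L. \<exists>f\<in>F. f \<^bold>\<and> c \<preceq> y}"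
    have "F \<subseteq> ?G"
    proof
      fix x assume x: "x \<in> F"
      then have "x \<^bold>\<and> c \<preceq> x"
        by simp
      with x show "x \<in> ?G"
        using normal_filterD(1) [OF F(1)] by blast
    qed
    moreover have "c \<in> ?G"
      using normal_filterD(2) [OF F(1)] by auto
    ultimately have "d \<in> ?G"
      using max [OF normal_filter_adjoin [OF F(1) that(1,2)]] \<open>c \<notin> F\<close> by blast
    then show ?thesis
      by auto
  qed
  have "core x \<in> F \<or> (core x)\<acute> \<in> F" if [simp]: "x \<in> carrier L" for x
  proof (rule ccontr)
    assume "\<not> ?thesis"
    then obtain f g where [simp]: "f \<in> F" "g \<in> F"
      and f: "f \<^bold>\<and> core x \<preceq> d" and g: "g \<^bold>\<and> (core x)\<acute> \<preceq> d"
      using adjoin [of "core x"] adjoin [of "(core x)\<acute>"]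
      by (auto simp: star_prime_core star_prime_prime_core)
    have "(f \<^bold>\<and> g) \<^bold>\<and> core x \<preceq> f \<^bold>\<and> core x" "(f \<^bold>\<and> g) \<^bold>\<and> (core x)\<acute> \<preceq> g \<^bold>\<and> (core x)\<acute>"
      by (simp_all add: leq_meet_iff meet_leqI1)
    then have "(f \<^bold>\<and> g) \<^bold>\<and> core x \<preceq> d" "(f \<^bold>\<and> g) \<^bold>\<and> (core x)\<acute> \<preceq> d"
      using leq_trans [OF _ f] leq_trans [OF _ g] by simp_all
    then have "(f \<^bold>\<and> g) \<^bold>\<and> (core x \<^bold>\<or> (core x)\<acute>) \<preceq> d"
      by (simp add: meet_join_distrib join_leq_iff)
    then have "f \<^bold>\<and> g \<preceq> d"
      by (simp add: core_complement)
    then show False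
      using F by (meson \<open>f \<in> F\<close> \<open>g \<in> F\<close> assms(1) normal_filterD(3,4))
  qed
  with F that show ?thesis
    by blast
qed

text \<open>The congruence of a normal filter: equality below some member of the filter.\<close>

definition filter_cong :: "'a set \<Rightarrow> 'a \<Rightarrow> 'a \<Rightarrow> bool" where
  "filter_cong F x y \<longleftrightarrow> (\<exists>f\<in>F. x \<^bold>\<and> f = y \<^bold>\<and> f)"

lemma filter_congI: "f \<in> F \<Longrightarrow> x \<^bold>\<and> f = y \<^bold>\<and> f \<Longrightarrow> filter_cong F x y"
  by (auto simp: filter_cong_def)

lemma filter_cong_refl: "normal_filter F \<Longrightarrow> filter_cong F x x"
  using normal_filterD(2) by (auto simp: filter_cong_def)

lemma filter_cong_sym: "filter_cong F x y \<Longrightarrow> filter_cong F y x"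
  by (auto simp: filter_cong_def) metis

lemma meet_eq_mono:
  assumes [simp]: "x \<in> carrier L" "y \<in> carrier L" "f \<in> carrier L" "g \<in> carrier L"
    and "x \<^bold>\<and> f = y \<^bold>\<and> f"
  shows "x \<^bold>\<and> (f \<^bold>\<and> g) = y \<^bold>\<and> (f \<^bold>\<and> g)"
  using assms(5) by (simp flip: meet_assoc)

lemma filter_cong_common:
  assumes F: "normal_filter F" and "filter_cong F x y" "filter_cong F v w"
    and [simp]: "x \<in> carrier L" "y \<in> carrier L" "v \<in> carrier L" "w \<in> carrier L"
  obtains f where "f \<in> F" "x \<^bold>\<and> f = y \<^bold>\<and> f" "v \<^bold>\<and> f = w \<^bold>\<and> f"
proof -
  note [simp] = normal_filterD(1) [OF F]
  obtain f g where [simp]: "f \<in> F" "g \<in> F" and fg: "x \<^bold>\<and> f = y \<^bold>\<and> f" "v \<^bold>\<and> g = w \<^bold>\<and> g"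
    using assms(2,3) by (auto simp: filter_cong_def)
  have "x \<^bold>\<and> (f \<^bold>\<and> g) = y \<^bold>\<and> (f \<^bold>\<and> g)" "v \<^bold>\<and> (f \<^bold>\<and> g) = w \<^bold>\<and> (f \<^bold>\<and> g)"
    using meet_eq_mono [of x y f g] meet_eq_mono [of v w g f] fg
    by (simp_all add: meet_comm [of g f])
  then show ?thesis
    using that [of "f \<^bold>\<and> g"] normal_filterD(3) [OF F, of f g] by simp
qed

lemma filter_cong_trans:
  assumes "normal_filter F" "filter_cong F x y" "filter_cong F y w"
    and "x \<in> carrier L" "y \<in> carrier L" "w \<in> carrier L"
  shows "filter_cong F x w"
proof -
  from filter_cong_common [OF assms(1-3)] assms(4-6)
  obtain f where "f \<in> F" "x \<^bold>\<and> f = y \<^bold>\<and> f" "y \<^bold>\<and> f = w \<^bold>\<and> f"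
    by blast
  then show ?thesis
    by (metis filter_congI)
qed

lemma filter_cong_ops:
  assumes F: "normal_filter F" and "filter_cong F x y" "filter_cong F v w"
    and [simp]: "x \<in> carrier L" "y \<in> carrier L" "v \<in> carrier L" "w \<in> carrier L"
  shows "filter_cong F (x \<^bold>\<or> v) (y \<^bold>\<or> w)" "filter_cong F (x \<^bold>\<and> v) (y \<^bold>\<and> w)"
    "filter_cong F (x \<^bold>\<rightarrow> v) (y \<^bold>\<rightarrow> w)"
proof -
  from filter_cong_common [OF assms] obtain f
    where f: "f \<in> F" "x \<^bold>\<and> f = y \<^bold>\<and> f" "v \<^bold>\<and> f = w \<^bold>\<and> f"
    by blast
  have [simp]: "f \<in> carrier L"
    using normal_filterD(1) [OF F] f(1) .
  have f': "f \<^bold>\<and> x = f \<^bold>\<and> y" "f \<^bold>\<and> v = f \<^bold>\<and> w"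
    using f by (simp_all add: meet_comm [of f])
  have "f \<^bold>\<and> (x \<^bold>\<or> v) = f \<^bold>\<and> (y \<^bold>\<or> w)"
    by (simp add: meet_join_distrib f')
  then show "filter_cong F (x \<^bold>\<or> v) (y \<^bold>\<or> w)"
    by (intro filter_congI [OF f(1)]) (simp add: meet_comm [of _ f])
  have "x \<^bold>\<and> (v \<^bold>\<and> f) = (x \<^bold>\<and> f) \<^bold>\<and> w"
    using f(3) by (simp add: meet_assoc meet_comm [of f w])
  also have "\<dots> = y \<^bold>\<and> (w \<^bold>\<and> f)"
    using f(2) by (simp add: meet_assoc meet_comm [of f w])
  finally show "filter_cong F (x \<^bold>\<and> v) (y \<^bold>\<and> w)"
    by (intro filter_congI [OF f(1)]) (simp add: meet_assoc)
  have "f \<^bold>\<and> (x \<^bold>\<rightarrow> v) = f \<^bold>\<and> (y \<^bold>\<rightarrow> w)"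
    using meet_imp_distrib [of f x v] meet_imp_distrib [of f y w] by (simp add: f')
  then show "filter_cong F (x \<^bold>\<rightarrow> v) (y \<^bold>\<rightarrow> w)"
    by (intro filter_congI [OF f(1)]) (simp add: meet_comm [of _ f])
qed

lemma filter_cong_prime:
  assumes F: "normal_filter F" and "filter_cong F x y"
    and [simp]: "x \<in> carrier L" "y \<in> carrier L"
  shows "filter_cong F (x\<acute>) (y\<acute>)"
proof -
  from assms(2) obtain f where f: "f \<in> F" "x \<^bold>\<and> f = y \<^bold>\<and> f"
    by (auto simp: filter_cong_def)
  have [simp]: "f \<in> carrier L"
    using normal_filterD(1) [OF F] f(1) .
  \<comment> \<open>Meeting with \<open>f'\<^sup>*\<close>, which lies in \<open>F\<close>, removes \<open>f'\<close> from \<open>(w \<and> f)' = w' \<or> f'\<close>.\<close>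
  have *: "w\<acute> \<^bold>\<and> f\<acute>\<star> = (w \<^bold>\<and> f)\<acute> \<^bold>\<and> f\<acute>\<star>" if [simp]: "w \<in> carrier L" for w
    by (simp add: prime_meet meet_comm [of _ "f\<acute>\<star>"] meet_join_distrib)
      (simp add: meet_comm [of "f\<acute>\<star>"])
  show ?thesis
    by (rule filter_congI [OF normal_filterD(5) [OF F f(1)]]) (simp add: * f(2))
qed

lemma filter_cong_one: "normal_filter F \<Longrightarrow> f \<in> F \<Longrightarrow> filter_cong F f \<one>"
  by (rule filter_congI [of f]) (simp_all add: normal_filterD(1))

text \<open>
  A chosen representative of the congruence class of \<open>x\<close>, depending on the class only. The
  quotient algebra has these representatives as elements.
\<close>

definition rep :: "'a set \<Rightarrow> 'a \<Rightarrow> 'a" where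
  "rep F x = (SOME y. y \<in> carrier L \<and> filter_cong F x y)"

lemma rep:
  assumes "normal_filter F" "x \<in> carrier L"
  shows "rep F x \<in> carrier L" "filter_cong F x (rep F x)"
  unfolding rep_def
  using someI [of "\<lambda>y. y \<in> carrier L \<and> filter_cong F x y" x] filter_cong_refl [OF assms(1)] assms(2)
  by auto

lemma rep_eq_iff:
  assumes F: "normal_filter F" and [simp]: "x \<in> carrier L" "y \<in> carrier L"
  shows "rep F x = rep F y \<longleftrightarrow> filter_cong F x y"
proof
  assume "rep F x = rep F y"
  then show "filter_cong F x y"
    using rep [OF F] filter_cong_sym filter_cong_trans [OF F] by (metis assms(2,3))
next
  assume "filter_cong F x y"
  then have "(w \<in> carrier L \<and> filter_cong F x w) = (w \<in> carrier L \<and> filter_cong F y w)" for w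
    using filter_cong_sym filter_cong_trans [OF F] by (metis assms(2,3))
  then show "rep F x = rep F y"
    by (simp add: rep_def)
qed

text \<open>The quotient by the congruence of \<open>F\<close>; its carrier is a subset of the carrier of \<open>L\<close>.\<close>

definition quotient :: "'a set \<Rightarrow> 'a alg" where
  "quotient F = \<lparr>carrier = rep F ` carrier L,
     ljoin = (\<lambda>x y. rep F (x \<^bold>\<or> y)),
     lmeet = (\<lambda>x y. rep F (x \<^bold>\<and> y)),
     limp = (\<lambda>x y. rep F (x \<^bold>\<rightarrow> y)),
     lprime = (\<lambda>x. rep F (x\<acute>)),
     lzero = rep F \<zero>,
     lone = rep F \<one>\<rparr>"

lemma quotient_hom:
  assumes F: "normal_filter F"
  shows "alg_hom (rep F) L (quotient F)"
  unfolding alg_hom_def quotient_def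
  by (auto simp: rep_eq_iff [OF F] rep(1) [OF F] filter_cong_ops [OF F] filter_cong_prime [OF F]
      rep(2) [OF F])

text \<open>
  If \<open>F\<close> contains the core \<open>c\<close>, then \<open>c\<close> becomes \<open>1\<close> in the quotient; if it contains \<open>c'\<close>, then
  \<open>c \<and> c' = 0\<close> makes \<open>c\<close> become \<open>0\<close>.
\<close>

lemma quotient_trivial_core:
  assumes F: "normal_filter F"
    and core: "\<And>x. x \<in> carrier L \<Longrightarrow> core x \<in> F \<or> (core x)\<acute> \<in> F"
    and Q: "jidl1_algebra (quotient F)"
    and q: "q \<in> carrier (quotient F)" "q \<noteq> \<one>\<^bsub>quotient F\<^esub>"
  shows "jidl1_algebra.core (quotient F) q = \<zero>\<^bsub>quotient F\<^esub>"
proof -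
  interpret Q: jidl1_algebra "quotient F"
    by (fact Q)
  from q(1) obtain x where [simp]: "x \<in> carrier L" and x: "q = rep F x"
    by (auto simp: quotient_def)
  have hom: "Q.core q = rep F (core x)" "rep F \<zero> = \<zero>\<^bsub>quotient F\<^esub>" "rep F \<one> = \<one>\<^bsub>quotient F\<^esub>"
    using quotient_hom [OF F]
    by (simp_all add: alg_hom_def Q.core_def core_def star_def x)
  from core [OF \<open>x \<in> carrier L\<close>] show ?thesis
  proof
    assume "core x \<in> F"
    then have "rep F (core x) = rep F \<one>"
      by (simp add: rep_eq_iff F filter_cong_one)
    then have "q = \<one>\<^bsub>quotient F\<^esub>"
      using Q.core_leq [OF q(1)] q(1) by (simp add: hom Q.one_leq_iff)
    with q(2) show ?thesis
      by simp
  next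
    assume "(core x)\<acute> \<in> F"
    then have "filter_cong F (core x) \<zero>"
      by (rule filter_congI) (simp add: core_complement)
    then show ?thesis
      by (simp add: hom(1) rep_eq_iff F flip: hom(2))
  qed
qed

end

section \<open>Homomorphisms and varieties\<close>

lemma eval_closed:
  assumes "algebra L" "range v \<subseteq> carrier L"
  shows "eval L v t \<in> carrier L"
proof -
  interpret algebra L
    by fact
  show ?thesis
    using assms(2) by (induction t) auto
qed

lemma eval_hom:
  assumes "alg_hom h L M" "algebra L" "range v \<subseteq> carrier L"
  shows "eval M (h \<circ> v) t = h (eval L v t)"
  using assms(1) by (induction t) (auto simp: alg_hom_def eval_closed [OF assms(2,3)])

lemma satisfies_hom_image:
  assumes h: "alg_hom h L M" "h ` carrier L = carrier M" and L: "algebra L" "satisfies L e"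
  shows "satisfies M e"
  unfolding satisfies_def
proof (intro allI impI)
  fix w :: "nat \<Rightarrow> 'b"
  assume "range w \<subseteq> carrier M"
  then have "\<forall>n. \<exists>x. x \<in> carrier L \<and> h x = w n"
    using h(2) by (metis imageE rangeI subsetD)
  then obtain v where v: "\<And>n. v n \<in> carrier L" "\<And>n. h (v n) = w n"
    by metis
  then have "w = h \<circ> v" "range v \<subseteq> carrier L"
    by auto
  then show "eval M w (fst e) = eval M w (snd e)"
    using eval_hom [OF h(1) L(1)] L(2) by (simp add: satisfies_def)
qed

lemma satisfies_embedding:
  assumes h: "alg_hom h L M" "inj_on h (carrier L)" and L: "algebra L" and M: "satisfies M e"
  shows "satisfies L e"
  unfolding satisfies_def
proof (intro allI impI)
  fix v :: "nat \<Rightarrow> 'a"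
  assume v: "range v \<subseteq> carrier L"
  then have "range (h \<circ> v) \<subseteq> carrier M"
    using h(1) by (auto simp: alg_hom_def)
  then have "h (eval L v (fst e)) = h (eval L v (snd e))"
    using M by (simp add: satisfies_def flip: eval_hom [OF h(1) L v])
  then show "eval L v (fst e) = eval L v (snd e)"
    using h(2) by (simp add: inj_on_eq_iff eval_closed [OF L v])
qed

lemma algebra_hom_image:
  assumes h: "alg_hom h L M" "h ` carrier L = carrier M" and "algebra L"
  shows "algebra M"
proof -
  interpret algebra L
    by fact
  have ops: "h x \<^bold>\<or>\<^bsub>M\<^esub> h y = h (x \<^bold>\<or>\<^bsub>L\<^esub> y)" "h x \<^bold>\<and>\<^bsub>M\<^esub> h y = h (x \<^bold>\<and>\<^bsub>L\<^esub> y)"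
    "h x \<^bold>\<rightarrow>\<^bsub>M\<^esub> h y = h (x \<^bold>\<rightarrow>\<^bsub>L\<^esub> y)" "(h x)\<acute>\<^bsub>M\<^esub> = h (x\<acute>\<^bsub>L\<^esub>)"
    if "x \<in> carrier L" "y \<in> carrier L" for x y
    using h(1) that by (simp_all add: alg_hom_def)
  have bounds: "\<zero>\<^bsub>M\<^esub> = h \<zero>\<^bsub>L\<^esub>" "\<one>\<^bsub>M\<^esub> = h \<one>\<^bsub>L\<^esub>"
    using h(1) by (simp_all add: alg_hom_def)
  show ?thesis
    by (unfold_locales; unfold h(2) [symmetric]) (auto simp: ops bounds)
qed

lemma variety_hom_image:
  assumes "variety K" "L \<in> K" "alg_hom h L M" "h ` carrier L = carrier M"
  shows "M \<in> K"
  using assms algebra_hom_image satisfies_hom_image by (fastforce simp: variety_def models_def)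

text \<open>The intersection of varieties defining the generated variety is itself a variety.\<close>

lemma generated_variety_models:
  assumes "\<And>L. L \<in> K \<Longrightarrow> algebra L"
  shows "generated_variety K = models {e. \<forall>L\<in>K. satisfies L e}" (is "_ = models ?E")
proof
  have "K \<subseteq> models ?E"
    using assms by (auto simp: models_def)
  then show "generated_variety K \<subseteq> models ?E"
    by (auto simp: generated_variety_def variety_def)
  have "models ?E \<subseteq> models E" if "K \<subseteq> models E" for E
    using that unfolding models_def by blast
  then show "models ?E \<subseteq> generated_variety K"
    by (auto simp: generated_variety_def variety_def)
qed

lemma generated_variety_least: "variety W \<Longrightarrow> K \<subseteq> W \<Longrightarrow> generated_variety K \<subseteq> W"
  by (auto simp: generated_variety_def)

lemma generated_variety_superset: "K \<subseteq> generated_variety K"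
  by (auto simp: generated_variety_def)

text \<open>The join is a chosen least upper bound, so uniqueness is needed to identify it.\<close>

lemma join_subvarieties_DQD_eqI:
  assumes "variety W" "W \<subseteq> DQD" "U \<subseteq> W" "V \<subseteq> W" "variety U" "variety V"
    and least: "\<And>X. variety X \<Longrightarrow> U \<subseteq> X \<Longrightarrow> V \<subseteq> X \<Longrightarrow> W \<subseteq> X"
  shows "U \<squnion>\<^bsub>subvarieties_DQD\<^esub> V = W"
proof -
  let ?S = "subvarieties_DQD"
  have "least ?S W (Upper ?S {U, V})"
    using assms by (auto simp: least_def Upper_def subvarieties_DQD_def)
  moreover have "X = W" if "least ?S X (Upper ?S {U, V})" for X
    using that calculation by (auto simp: least_def subvarieties_DQD_def)
  ultimately show ?thesis
    unfolding join_def sup_def by (rule some_equality)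
qed

text \<open>The axioms of \<open>JIDL\<^sub>1\<close> as formal identities in the variables 0, 1 and 2.\<close>

definition jidl1_identities :: "identity set" where
  "jidl1_identities = (let x = Var 0; y = Var 1; w = Var 2; st = (\<lambda>t. Imp t Zero) in
    {(Join (Join x y) w, Join x (Join y w)),
     (Meet (Meet x y) w, Meet x (Meet y w)),
     (Join x y, Join y x),
     (Meet x y, Meet y x),
     (Join x (Meet x y), x),
     (Meet x (Join x y), x),
     (Meet Zero x, Zero),
     (Meet x One, x),
     (Meet x (Imp x y), Meet x y),
     (Meet x (Imp y w), Meet x (Imp (Meet x y) (Meet x w))),
     (Imp x x, One),
     (Prime Zero, One),
     (Prime One, Zero),
     (Prime (Meet x y), Join (Prime x) (Prime y)),
     (Prime (Prime (Join x y)), Join (Prime (Prime x)) (Prime (Prime y))),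
     (Meet (Prime (Prime x)) x, Prime (Prime x)),
     (Join (Prime x) (Imp y w), Imp (Join (Prime x) y) (Join (Prime x) w)),
     (Join (Imp x y) (Imp y x), One),
     (Meet x (st (Prime x)), st (Prime (Meet x (st (Prime x)))))})"

lemma (in jidl1_algebra) in_models_jidl1_identities: "L \<in> models jidl1_identities"
proof -
  have "eval L v (fst e) = eval L v (snd e)"
    if "e \<in> jidl1_identities" "range v \<subseteq> carrier L" for e v
  proof -
    from that(2) have v: "v n \<in> carrier L" for n
      by auto
    show ?thesis
      using that(1) unfolding jidl1_identities_def Let_def insert_iff empty_iff
      by (elim disjE FalseE, simp_all only: fst_conv snd_conv eval.simps)
        (rule join_assoc meet_assoc join_comm meet_comm join_absorb meet_absorb
          zero_least one_greatest meet_imp meet_imp_distrib imp_refl prime_zero prime_one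
          prime_meet prime_prime_join prime_prime_le join_imp_distrib prelinear
          level_one [unfolded star_def]; (intro v)?; fail)+
  qed
  then show ?thesis
    by (auto simp: models_def satisfies_def algebra_axioms)
qed

lemma jidl1_algebra_if_model:
  fixes L (structure)
  assumes L: "L \<in> models jidl1_identities"
  shows "jidl1_algebra L"
proof -
  interpret algebra L
    using L by (simp add: models_def)
  \<comment> \<open>Each axiom is the evaluation of its identity at an assignment to these three variables.\<close>
  define val where "val x y w n = (if n = 0 then x else if n = 1 then y else w)"
    for x y w :: 'a and n :: nat
  have val: "val x y w 0 = x" "val x y w 1 = y" "val x y w 2 = w" for x y w
    by (simp_all add: val_def)
  have "\<forall>e\<in>jidl1_identities. eval L (val x y w) (fst e) = eval L (val x y w) (snd e)"
    if "x \<in> carrier L" "y \<in> carrier L" "w \<in> carrier L" for x y w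
  proof -
    have "range (val x y w) \<subseteq> carrier L"
      using that by (auto simp: val_def)
    then show ?thesis
      using L by (auto simp: models_def satisfies_def)
  qed
  note ids = this [unfolded jidl1_identities_def Let_def ball_simps fst_conv snd_conv eval.simps val,
      folded star_def]
  show ?thesis
    by (unfold_locales; metis ids zero_closed)
qed

lemma JIDL1_eq_models: "JIDL1 = models jidl1_identities"
  by (auto simp: JIDL1_def jidl1_algebra_if_model jidl1_algebra.in_models_jidl1_identities)

lemma variety_JIDL1: "variety JIDL1"
  using JIDL1_eq_models by (auto simp: variety_def)

section \<open>The two generating classes\<close>

lemma dually_stone_heyting_chain_jidl1:
  fixes L (structure)
  assumes "dually_stone_heyting_chain L"
  shows "jidl1_algebra L"
proof -
  interpret dually_stone_heyting_chain L
    by fact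
  \<comment> \<open>In a chain \<open>x' \<and> x'' = 0\<close> forces \<open>x' = 0\<close>, so \<open>1 = x'' \<le> x\<close>, or \<open>x'' = 0\<close>, so \<open>x' = x''' = 1\<close>.\<close>
  have prime_cases: "x\<acute> = \<one> \<or> x = \<one>" if [simp]: "x \<in> carrier L" for x
  proof -
    have "x\<acute> = \<zero> \<or> x\<acute>\<acute> = \<zero>"
      using chain [of "x\<acute>" "x\<acute>\<acute>"] by (auto simp: dually_stone)
    then show ?thesis
      using prime_prime_prime [of x] prime_prime_leq [of x] by (auto simp: prime_zero one_leq_iff)
  qed
  show ?thesis
  proof unfold_locales
    fix x assume [simp]: "x \<in> carrier L"
    show "x \<^bold>\<and> x\<acute>\<star> = (x \<^bold>\<and> x\<acute>\<star>)\<acute>\<star>"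
      using prime_cases [of x] by (auto simp: prime_zero prime_one)
    fix y assume [simp]: "y \<in> carrier L"
    have "x \<preceq> y \<or> y \<preceq> x"
      using chain [of x y] by (auto simp: leq_def meet_comm)
    then show "(x \<^bold>\<rightarrow> y) \<^bold>\<or> (y \<^bold>\<rightarrow> x) = \<one>"
      by (auto simp: imp_eq_one)
    fix w assume [simp]: "w \<in> carrier L"
    show "x\<acute> \<^bold>\<or> (y \<^bold>\<rightarrow> w) = (x\<acute> \<^bold>\<or> y) \<^bold>\<rightarrow> (x\<acute> \<^bold>\<or> w)"
      using prime_cases [of x] by (auto simp: prime_one imp_refl)
  qed
qed

lemma D2_jidl1:
  assumes "distinct [z, a, b, u]"
  shows "jidl1_algebra (D2 z a b u)"
proof -
  let ?D = "D2 z a b u"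
  have car: "carrier ?D = {z, a, b, u}"
    by (simp add: D2_def)
  have ne: "z \<noteq> a" "z \<noteq> b" "z \<noteq> u" "a \<noteq> b" "a \<noteq> u" "b \<noteq> u"
    "a \<noteq> z" "b \<noteq> z" "u \<noteq> z" "b \<noteq> a" "u \<noteq> a" "u \<noteq> b"
    using assms by auto
  show ?thesis
    by (unfold_locales; (unfold car)?; (elim insertE emptyE)?;
        simp add: ne D2_def join4_def meet4_def compl4_def star_def)
qed

text \<open>
  The two classes of generators refute every identity that fails somewhere in \<open>JIDL\<^sub>1\<close>.
\<close>

lemma jidl1_refutation:
  fixes L :: "'a alg" (structure)
  assumes "jidl1_algebra L" "\<not> satisfies L e" and dist: "distinct [z, a, b, u]"
  shows "(\<exists>Q :: 'a alg. dually_stone_heyting_chain Q \<and> \<not> satisfies Q e) \<or> \<not> satisfies (D2 z a b u) e"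
proof -
  interpret jidl1_algebra L
    by fact
  obtain v where v: "range v \<subseteq> carrier L" and ne: "eval L v (fst e) \<noteq> eval L v (snd e)"
    using assms(2) by (auto simp: satisfies_def)
  define s where "s = eval L v (fst e)"
  define t where "t = eval L v (snd e)"
  have [simp]: "s \<in> carrier L" "t \<in> carrier L"
    using eval_closed [OF algebra_axioms v] by (simp_all add: s_def t_def)
  have "(s \<^bold>\<rightarrow> t) \<^bold>\<and> (t \<^bold>\<rightarrow> s) \<noteq> \<one>"
  proof
    assume "(s \<^bold>\<rightarrow> t) \<^bold>\<and> (t \<^bold>\<rightarrow> s) = \<one>"
    then have "s \<preceq> t" "t \<preceq> s"
      using leq_meet_iff [of "s \<^bold>\<rightarrow> t" "t \<^bold>\<rightarrow> s" \<one>] by (simp_all add: one_leq_iff imp_eq_one_iff)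
    then show False
      using ne by (simp add: leq_antisym flip: s_def t_def)
  qed
  then obtain F where F: "normal_filter F" "(s \<^bold>\<rightarrow> t) \<^bold>\<and> (t \<^bold>\<rightarrow> s) \<notin> F"
    and core: "\<And>x. x \<in> carrier L \<Longrightarrow> core x \<in> F \<or> (core x)\<acute> \<in> F"
    using separating_normal_filter [of "(s \<^bold>\<rightarrow> t) \<^bold>\<and> (t \<^bold>\<rightarrow> s)"] by auto
  let ?Q = "quotient F"
  have hom: "alg_hom (rep F) L ?Q"
    by (rule quotient_hom [OF F(1)])
  have surj: "rep F ` carrier L = carrier ?Q"
    by (simp add: quotient_def)
  have "?Q \<in> JIDL1"
    using variety_hom_image [OF variety_JIDL1 _ hom surj] jidl1_algebra_axioms by (simp add: JIDL1_def)
  then interpret Q: jidl1_algebra ?Q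
    by (simp add: JIDL1_def)
  have "\<not> filter_cong F s t"
  proof
    assume "filter_cong F s t"
    then obtain f where f: "f \<in> F" "s \<^bold>\<and> f = t \<^bold>\<and> f"
      by (auto simp: filter_cong_def)
    have [simp]: "f \<in> carrier L"
      using normal_filterD(1) [OF F(1) f(1)] .
    have "f \<^bold>\<and> s \<preceq> t" "f \<^bold>\<and> t \<preceq> s"
      using meet_leq1 [of t f] meet_leq1 [of s f] f(2) by (simp_all add: meet_comm [of f])
    then have "f \<preceq> (s \<^bold>\<rightarrow> t) \<^bold>\<and> (t \<^bold>\<rightarrow> s)"
      by (simp add: leq_meet_iff leq_imp_iff)
    then show False
      using normal_filterD(4) [OF F(1) _ f(1)] F(2) by simp
  qed
  then have "rep F s \<noteq> rep F t"
    by (simp add: rep_eq_iff F(1))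
  moreover have "range (rep F \<circ> v) \<subseteq> carrier ?Q"
    using v by (auto simp: quotient_def)
  ultimately have nsat: "\<not> satisfies ?Q e"
    using eval_hom [OF hom algebra_axioms v]
    by (auto simp: satisfies_def s_def t_def intro!: exI [of _ "rep F \<circ> v"])
  have cases: "q = \<one>\<^bsub>?Q\<^esub> \<or> q\<acute>\<^bsub>?Q\<^esub> = \<one>\<^bsub>?Q\<^esub> \<or> q\<acute>\<^bsub>?Q\<^esub> = q" if "q \<in> carrier ?Q" for q
    using Q.trivial_core_cases [OF quotient_trivial_core [OF F(1) core Q.jidl1_algebra_axioms] that] .
  show ?thesis
  proof (cases "\<exists>p\<in>carrier ?Q. p\<acute>\<^bsub>?Q\<^esub> = p \<and> p \<noteq> \<zero>\<^bsub>?Q\<^esub>")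
    case True
    then obtain p where "p \<in> carrier ?Q" "p\<acute>\<^bsub>?Q\<^esub> = p" "p \<noteq> \<zero>\<^bsub>?Q\<^esub>"
      by blast
    then obtain h where "alg_hom h ?Q (D2 z a b u)" "inj_on h (carrier ?Q)"
      using Q.trivial_core_embeds_D2 [OF cases _ _ _ dist] by blast
    then show ?thesis
      using satisfies_embedding Q.algebra_axioms nsat by blast
  next
    case False
    then have "q = \<one>\<^bsub>?Q\<^esub> \<or> q\<acute>\<^bsub>?Q\<^esub> = \<one>\<^bsub>?Q\<^esub>" if "q \<in> carrier ?Q" for q
      using cases [OF that] that Q.prime_zero by auto
    then have "dually_stone_heyting_chain ?Q"
      by (rule Q.trivial_core_chain)
    then show ?thesis
      using nsat by blast
  qed
qed

theorem corollary6p8: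
  fixes z a b u :: 'a
  assumes "infinite (UNIV :: 'a set)"
    and "distinct [z, a, b, u]"
  shows "(JIDL1 :: 'a alg set) =
    DStHC \<squnion>\<^bsub>subvarieties_DQD\<^esub> generated_variety {D2 z a b u}"
proof (rule join_subvarieties_DQD_eqI [symmetric])
  let ?C = "{L :: 'a alg. dually_stone_heyting_chain L}"
  have C: "?C \<subseteq> JIDL1" and D: "{D2 z a b u} \<subseteq> JIDL1"
    using dually_stone_heyting_chain_jidl1 D2_jidl1 [OF assms(2)] by (auto simp: JIDL1_def)
  show "variety (JIDL1 :: 'a alg set)"
    by (rule variety_JIDL1)
  show "JIDL1 \<subseteq> (DQD :: 'a alg set)"
    by (auto simp: JIDL1_def DQD_def jidl1_algebra.axioms)
  show "DStHC \<subseteq> (JIDL1 :: 'a alg set)" "generated_variety {D2 z a b u} \<subseteq> JIDL1"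
    unfolding DStHC_def using C D generated_variety_least [OF variety_JIDL1] by blast+
  have "algebra L" if "L \<in> JIDL1" for L :: "'a alg"
    using that JIDL1_eq_models by (auto simp: models_def)
  then show "variety (DStHC :: 'a alg set)" "variety (generated_variety {D2 z a b u})"
    unfolding DStHC_def variety_def
    using generated_variety_models [of ?C] generated_variety_models [of "{D2 z a b u}"] C D by blast+
  fix X :: "'a alg set"
  assume "variety X" "DStHC \<subseteq> X" "generated_variety {D2 z a b u} \<subseteq> X"
  then obtain E where E: "X = models E" "?C \<subseteq> models E" "D2 z a b u \<in> models E"
    unfolding DStHC_def variety_def
    using generated_variety_superset [of ?C] generated_variety_superset [of "{D2 z a b u}"] by blast
  show "JIDL1 \<subseteq> X"
  proof
    fix L :: "'a alg"
    assume L: "L \<in> JIDL1"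
    have "satisfies L e" if "e \<in> E" for e
      using jidl1_refutation [OF _ _ assms(2), of L e] L that E(2,3)
      by (auto simp: models_def JIDL1_def)
    then show "L \<in> X"
      using L JIDL1_eq_models by (auto simp: E(1) models_def)
  qed
qed

end
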